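(* Let $T$ be a connected tree on $n\geq 3$ vertices. Then $\mathbb{H}(T)=0$, where $\mathbb{H}$ denotes bold homology with coefficients in a field.
   Context: Bold homology. Let $G$ be a finite simple graph and $\mathbb{K}$ a field; order $V(G)$. A bi-colouring is a map $\varepsilon\colon V(G)\to\{0,1\}$, and $G_\varepsilon$ denotes the subgraph of $G$ induced by the vertices $v$ with $\varepsilon(v)=1$. Write $\varepsilon\,\widetilde{\triangleleft}\,\varepsilon'$ if $\varepsilon'$ is obtained from $\varepsilon$ by changing the value at exactly one vertex from $0$ to $1$. A sign assignment is a choice of $s(\varepsilon,\varepsilon')\in\mathbb{Z}/2$ for each such pair with $s(\varepsilon,\varepsilon_1)+s(\varepsilon_1,\varepsilon'')\equiv s(\varepsilon,\varepsilon_2)+s(\varepsilon_2,\varepsilon'')+1\pmod 2$ whenever $\varepsilon\,\widetilde{\triangleleft}\,\varepsilon_1,\varepsilon_2\,\widetilde{\triangleleft}\,\varepsilon''$, $\varepsilon_1\neq\varepsilon_2$; it exists and the choice does not affect the complex up to isomorphism. The bold chain group is \[\mathrm{C}\mathbb{H}_i(G)=\bigoplus_{\varepsilon:\ \sum_v\varepsilon(v)=i}\ \bigoplus_{x\in\pi_0(G_\varepsilon)}\mathbb{K}\langle x\rangle,\] where $\pi_0$ is the set of connected components (so $\mathrm{C}\mathbb{H}_0=0$), with differential $d^i\colon \mathrm{C}\mathbb{H}_i\to\mathrm{C}\mathbb{H}_{i+1}$ given for $x\in\pi_0(G_\varepsilon)$ by $d^i(x)=\sum(-1)^{s(\varepsilon,\varepsilon')}y$,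 the sum over all $\varepsilon'$ with $\varepsilon\,\widetilde{\triangleleft}\,\varepsilon'$ and the component $y\in\pi_0(G_{\varepsilon'})$ with $V(x)\subseteq V(y)$. Its homology is the bold homology $\mathbb{H}_*(G)$. *)

theory Defs
  imports
    "Graph_Theory.Digraph_Component"
    "HOL-Algebra.Elementary_Groups"
    "HOL-Library.Poly_Mapping"
begin

text \<open>
  A finite simple graph is a finite symmetric digraph without loops and parallel arcs (locale
  \<open>graph\<close>), each edge being a pair of opposite arcs. The AFP predicate \<open>tree\<close>
  does not fit, since there the closed walk \<open>a, b, a\<close> counts as a cycle; the cycles of a
  simple graph are the cycles of length at least 3 of the symmetric digraph.
\<close>

definition simple_tree :: "('v, 'e) pre_digraph \<Rightarrow> bool" where
  "simple_tree T \<longleftrightarrow>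
     graph T \<and> Digraph_Component.connected T \<and>
     \<not> (\<exists>p. pre_digraph.cycle T p \<and> 3 \<le> length p)"

text \<open>Maps \<open>V(G) \<rightarrow> {0,1}\<close>, made extensional so that each one is counted once.\<close>

type_synonym 'v bicolouring = "'v \<Rightarrow> nat"

definition bicolourings :: "('v, 'e) pre_digraph \<Rightarrow> 'v bicolouring set" where
  "bicolourings G = (verts G \<rightarrow>\<^sub>E {0, 1})"

definition coloured_subgraph :: "('v, 'e) pre_digraph \<Rightarrow> 'v bicolouring \<Rightarrow> ('v, 'e) pre_digraph" where
  "coloured_subgraph G \<epsilon> = G \<restriction> {v \<in> verts G. \<epsilon> v = 1}"

text \<open>
  Connected components are represented by their vertex sets; in a symmetric digraph they are
  the strongly connected components.
\<close>

definition comps :: "('v, 'e) pre_digraph \<Rightarrow> 'v bicolouring \<Rightarrow> 'v set set" where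
  "comps G \<epsilon> = pre_digraph.sccs_verts (coloured_subgraph G \<epsilon>)"

definition covers :: "('v, 'e) pre_digraph \<Rightarrow> 'v bicolouring \<Rightarrow> 'v bicolouring \<Rightarrow> bool" where
  "covers G \<epsilon> \<epsilon>' \<longleftrightarrow>
     \<epsilon> \<in> bicolourings G \<and> \<epsilon>' \<in> bicolourings G \<and> (\<exists>v\<in>verts G. \<epsilon> v = 0 \<and> \<epsilon>' = \<epsilon>(v := 1))"

text \<open>Elements of \<open>\<int>/2\<close> are represented by the naturals 0 and 1.\<close>

definition sign_assignment ::
  "('v, 'e) pre_digraph \<Rightarrow> ('v bicolouring \<Rightarrow> 'v bicolouring \<Rightarrow> nat) \<Rightarrow> bool" where
  "sign_assignment G s \<longleftrightarrow>
     (\<forall>\<epsilon> \<epsilon>'. covers G \<epsilon> \<epsilon>' \<longrightarrow> s \<epsilon> \<epsilon>' \<in> {0, 1}) \<and>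
     (\<forall>\<epsilon> \<epsilon>1 \<epsilon>2 \<epsilon>''.
        covers G \<epsilon> \<epsilon>1 \<and> covers G \<epsilon>1 \<epsilon>'' \<and> covers G \<epsilon> \<epsilon>2 \<and> covers G \<epsilon>2 \<epsilon>'' \<and> \<epsilon>1 \<noteq> \<epsilon>2 \<longrightarrow>
        (s \<epsilon> \<epsilon>1 + s \<epsilon>1 \<epsilon>'') mod 2 = (s \<epsilon> \<epsilon>2 + s \<epsilon>2 \<epsilon>'' + 1) mod 2)"

text \<open>
  The basis element \<open>x \<in> \<pi>\<^sub>0(G\<^sub>\<epsilon>)\<close> is the pair \<open>(\<epsilon>, x)\<close>. Degrees are
  integers, so that the chain groups vanish in negative degrees.
\<close>

type_synonym ('v, 'k) bold_chain = "('v bicolouring \<times> 'v set) \<Rightarrow>\<^sub>0 'k"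

definition bold_basis :: "('v, 'e) pre_digraph \<Rightarrow> int \<Rightarrow> ('v bicolouring \<times> 'v set) set" where
  "bold_basis G i =
     {(\<epsilon>, x). \<epsilon> \<in> bicolourings G \<and> int (\<Sum>v\<in>verts G. \<epsilon> v) = i \<and> x \<in> comps G \<epsilon>}"

definition bold_chain_group ::
  "('v, 'e) pre_digraph \<Rightarrow> int \<Rightarrow> ('v, 'k::field) bold_chain monoid" where
  "bold_chain_group G i =
     \<lparr>carrier = {c. Poly_Mapping.keys c \<subseteq> bold_basis G i}, monoid.mult = (+), one = 0\<rparr>"

definition bold_differential ::
  "('v, 'e) pre_digraph \<Rightarrow> ('v bicolouring \<Rightarrow> 'v bicolouring \<Rightarrow> nat) \<Rightarrow>
     ('v, 'k::field) bold_chain \<Rightarrow> ('v, 'k) bold_chain" where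
  "bold_differential G s c =
     (\<Sum>(\<epsilon>, x)\<in>Poly_Mapping.keys c.
        \<Sum>(\<epsilon>', y)\<in>{(\<epsilon>', y). covers G \<epsilon> \<epsilon>' \<and> y \<in> comps G \<epsilon>' \<and> x \<subseteq> y}.
          Poly_Mapping.single (\<epsilon>', y) (Poly_Mapping.lookup c (\<epsilon>, x) * (-1) ^ s \<epsilon> \<epsilon>'))"

definition bold_cycles ::
  "('v, 'e) pre_digraph \<Rightarrow> ('v bicolouring \<Rightarrow> 'v bicolouring \<Rightarrow> nat) \<Rightarrow> int \<Rightarrow>
     ('v, 'k::field) bold_chain set" where
  "bold_cycles G s i = {c \<in> carrier (bold_chain_group G i). bold_differential G s c = 0}"

definition bold_boundaries ::
  "('v, 'e) pre_digraph \<Rightarrow> ('v bicolouring \<Rightarrow> 'v bicolouring \<Rightarrow> nat) \<Rightarrow> int \<Rightarrow>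
     ('v, 'k::field) bold_chain set" where
  "bold_boundaries G s i = bold_differential G s ` carrier (bold_chain_group G (i - 1))"

definition bold_homology ::
  "('v, 'e) pre_digraph \<Rightarrow> ('v bicolouring \<Rightarrow> 'v bicolouring \<Rightarrow> nat) \<Rightarrow> int \<Rightarrow>
     ('v, 'k::field) bold_chain set monoid" where
  "bold_homology G s i =
     (bold_chain_group G i)\<lparr>carrier := bold_cycles G s i\<rparr> Mod bold_boundaries G s i"

text \<open>Sign assignments exist: count modulo 2 the coloured vertices preceding the changed one.\<close>

lemma sign_assignment_exists:
  assumes "finite (verts G)"
  shows "\<exists>s. sign_assignment G s"
proof -
  obtain f :: "'a \<Rightarrow> nat" where f: "inj_on f (verts G)"
    using finite_imp_inj_to_nat_seg[OF assms] by blast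
  define N where "N \<epsilon> v = (\<Sum>w\<in>{w\<in>verts G. f w < f v}. \<epsilon> w)" for \<epsilon> :: "'a \<Rightarrow> nat" and v
  define s where "s \<epsilon> \<epsilon>' = N \<epsilon> (THE v. \<epsilon> v \<noteq> \<epsilon>' v) mod 2" for \<epsilon> \<epsilon>' :: "'a \<Rightarrow> nat"
  have s: "s \<epsilon> (\<epsilon>(v := 1)) = N \<epsilon> v mod 2" if "\<epsilon> v = 0" for \<epsilon> v
  proof -
    have "(THE u. \<epsilon> u \<noteq> (\<epsilon>(v := 1)) u) = v"
      using that by (intro the_equality) (auto split: if_splits)
    then show ?thesis by (simp add: s_def)
  qed
  have N: "N (\<epsilon>(v := 1)) u = N \<epsilon> u + (if f v < f u then 1 else 0)"
    if "\<epsilon> v = 0" "v \<in> verts G" for \<epsilon> u v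
  proof -
    let ?A = "{w\<in>verts G. f w < f u}"
    have "N (\<epsilon>(v := 1)) u = (\<Sum>w\<in>?A. \<epsilon> w + (if w = v then 1 else 0))"
      unfolding N_def using that by (intro sum.cong) auto
    also have "\<dots> = N \<epsilon> u + (if v \<in> ?A then 1 else 0)"
      using assms by (simp add: sum.distrib N_def)
    finally show ?thesis using that by simp
  qed
  have "(s \<epsilon> \<epsilon>1 + s \<epsilon>1 \<epsilon>'') mod 2 = (s \<epsilon> \<epsilon>2 + s \<epsilon>2 \<epsilon>'' + 1) mod 2"
    if c: "covers G \<epsilon> \<epsilon>1" "covers G \<epsilon>1 \<epsilon>''" "covers G \<epsilon> \<epsilon>2" "covers G \<epsilon>2 \<epsilon>''" "\<epsilon>1 \<noteq> \<epsilon>2"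
    for \<epsilon> \<epsilon>1 \<epsilon>2 \<epsilon>''
  proof -
    obtain v where v: "v \<in> verts G" "\<epsilon> v = 0" "\<epsilon>1 = \<epsilon>(v := 1)" using c unfolding covers_def by blast
    obtain u where u: "u \<in> verts G" "\<epsilon>1 u = 0" "\<epsilon>'' = \<epsilon>1(u := 1)" using c unfolding covers_def by blast
    obtain a where a: "a \<in> verts G" "\<epsilon> a = 0" "\<epsilon>2 = \<epsilon>(a := 1)" using c unfolding covers_def by blast
    obtain b where b: "b \<in> verts G" "\<epsilon>2 b = 0" "\<epsilon>'' = \<epsilon>2(b := 1)" using c unfolding covers_def by blast
    have uv: "u \<noteq> v" using u v by auto
    have av: "a \<noteq> v" using a v c by auto
    have "\<epsilon>'' a = 1" using a b by auto
    then have au: "a = u" using u v a av by (auto split: if_splits)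
    have "\<epsilon>'' v = 1" using u v by auto
    then have bv: "b = v" using a b v av by (auto split: if_splits)
    have "\<epsilon> u = 0" using a au by simp
    have changed1: "s \<epsilon> \<epsilon>1 = N \<epsilon> v mod 2" "s \<epsilon> \<epsilon>2 = N \<epsilon> u mod 2"
      using s[of \<epsilon> v] s[of \<epsilon> u] v a au by auto
    have changed2: "s \<epsilon>1 \<epsilon>'' = (N \<epsilon> u + (if f v < f u then 1 else 0)) mod 2"
      "s \<epsilon>2 \<epsilon>'' = (N \<epsilon> v + (if f u < f v then 1 else 0)) mod 2"
      using s[of \<epsilon>1 u] N[of \<epsilon> v u] u v s[of \<epsilon>2 v] N[of \<epsilon> u v] a b au bv by simp_all
    have "f u \<noteq> f v" using f uv u v by (auto dest: inj_onD)
    then have "s \<epsilon>1 \<epsilon>'' = N \<epsilon> u mod 2 \<and> s \<epsilon>2 \<epsilon>'' = (N \<epsilon> v + 1) mod 2 \<or>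
        s \<epsilon>1 \<epsilon>'' = (N \<epsilon> u + 1) mod 2 \<and> s \<epsilon>2 \<epsilon>'' = N \<epsilon> v mod 2"
      using changed2 by (cases "f u < f v") simp_all
    moreover have "(p mod 2 + q mod 2) mod 2 = (q mod 2 + (p + 1) mod 2 + 1) mod 2"
      "(p mod 2 + (q + 1) mod 2) mod 2 = (q mod 2 + p mod 2 + 1) mod 2" for p q :: nat
      by (cases "even p"; cases "even q"; simp add: mod_2_eq_odd)+
    ultimately show ?thesis unfolding changed1 by (elim disjE conjE) (simp_all only:)
  qed
  moreover have "s \<epsilon> \<epsilon>' \<in> {0, 1}" for \<epsilon> \<epsilon>' unfolding s_def by auto
  ultimately show ?thesis unfolding sign_assignment_def by blast
qed

end

theory Submission
  imports Defs
begin

text \<open>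
  A tree with at least two vertices has a leaf \<open>v\<close>; let \<open>u\<close> be its neighbour. The
  colourings with \<open>v\<close> off and those with \<open>v\<close> on exhibit the bold complex as the
  mapping cone of the map that switches \<open>v\<close> on. On components this map is
  injective, because adding a leaf merges no components and only enlarges the component of
  \<open>u\<close> if \<open>u\<close> is on (\<open>component_of_insert_pendant\<close>). So the homology is,
  up to a shift of degree, that of its cokernel. The cokernel is spanned by the isolated components \<open>{v}\<close>, one for each
  colouring with \<open>v\<close> on and \<open>u\<close> off. It is therefore the complex of a cube on the
  remaining vertices, which is acyclic as soon as there is a third vertex \<open>w\<close>: switching
  \<open>w\<close> on pairs its basis elements.

  Instead of using exact sequences, the two cancellations are carried out together
  as one acyclic matching on the basis of the bold complex (\<open>bold_cycle_is_boundary\<close>), and a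
  triangularity argument shows that a complex with such a perfect matching is exact
  (\<open>exact_if_acyclic_matching\<close>). The leaf is found at the end of a longest path
  (\<open>simple_tree_has_pendant_vertex\<close>).
\<close>

section \<open>Exactness from acyclic matchings\<close>

text \<open>
  The complex is given by its matrix \<open>M\<close> with respect to a finite basis \<open>B\<close> of all
  degrees together. Exactness then becomes a statement about single matrix entries.
\<close>

locale based_complex =
  fixes B :: "'b set" and deg :: "'b \<Rightarrow> int" and M :: "'b \<Rightarrow> 'b \<Rightarrow> 'k::field"
  assumes finite_basis: "finite B"
    and entry_degree: "p \<in> B \<Longrightarrow> M p q \<noteq> 0 \<Longrightarrow> q \<in> B \<and> deg q = deg p + 1"
    and entries_compose_zero: "p \<in> B \<Longrightarrow> r \<in> B \<Longrightarrow> (\<Sum>q\<in>B. M p q * M q r) = 0"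
begin

definition graded_part :: "int \<Rightarrow> ('b \<Rightarrow>\<^sub>0 'k) set" where
  "graded_part i = {c. Poly_Mapping.keys c \<subseteq> {p \<in> B. deg p = i}}"

definition boundary :: "('b \<Rightarrow>\<^sub>0 'k) \<Rightarrow> ('b \<Rightarrow>\<^sub>0 'k)" where
  "boundary c = (\<Sum>p\<in>Poly_Mapping.keys c. \<Sum>q\<in>B. Poly_Mapping.single q (Poly_Mapping.lookup c p * M p q))"

lemma lookup_boundary:
  assumes "Poly_Mapping.keys c \<subseteq> B"
  shows "Poly_Mapping.lookup (boundary c) q = (\<Sum>p\<in>B. Poly_Mapping.lookup c p * M p q)"
proof -
  have "Poly_Mapping.lookup (boundary c) q
      = (\<Sum>p\<in>Poly_Mapping.keys c. Poly_Mapping.lookup c p * M p q)"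
    unfolding boundary_def lookup_sum lookup_single
  proof (rule sum.cong[OF refl])
    fix p assume "p \<in> Poly_Mapping.keys c"
    then have "p \<in> B" using assms by blast
    have "(\<Sum>r\<in>B. Poly_Mapping.lookup c p * M p r when r = q)
        = (if q \<in> B then Poly_Mapping.lookup c p * M p q else 0)"
      by (simp add: when_def finite_basis)
    also have "\<dots> = Poly_Mapping.lookup c p * M p q"
      using entry_degree[OF \<open>p \<in> B\<close>] by auto
    finally show "(\<Sum>r\<in>B. Poly_Mapping.lookup c p * M p r when r = q)
        = Poly_Mapping.lookup c p * M p q" .
  qed
  also have "\<dots> = (\<Sum>p\<in>B. Poly_Mapping.lookup c p * M p q)"
    by (rule sum.mono_neutral_left) (use assms finite_basis in \<open>auto simp: in_keys_iff\<close>)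
  finally show ?thesis .
qed

lemma graded_part_in_basis: "c \<in> graded_part i \<Longrightarrow> Poly_Mapping.keys c \<subseteq> B"
  by (auto simp: graded_part_def)

lemma graded_part_iff:
  "c \<in> graded_part i \<longleftrightarrow> (\<forall>p. Poly_Mapping.lookup c p \<noteq> 0 \<longrightarrow> p \<in> B \<and> deg p = i)"
  by (auto simp: graded_part_def in_keys_iff)

lemma zero_chain: "0 \<in> graded_part i"
  by (simp add: graded_part_def)

lemma add_chain: "a \<in> graded_part i \<Longrightarrow> b \<in> graded_part i \<Longrightarrow> a + b \<in> graded_part i"
  unfolding graded_part_iff lookup_add by (metis add_0)

lemma diff_chain: "a \<in> graded_part i \<Longrightarrow> b \<in> graded_part i \<Longrightarrow> a - b \<in> graded_part i"
  unfolding graded_part_iff lookup_minus by (metis diff_0_right)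

lemma boundary_add:
  assumes "a \<in> graded_part i" "b \<in> graded_part i"
  shows "boundary (a + b) = boundary a + boundary b"
  using assms add_chain[OF assms]
  by (intro poly_mapping_eqI)
    (simp add: lookup_boundary lookup_add graded_part_in_basis ring_distribs sum.distrib)

lemma boundary_diff:
  assumes "a \<in> graded_part i" "b \<in> graded_part i"
  shows "boundary (a - b) = boundary a - boundary b"
  using assms diff_chain[OF assms]
  by (intro poly_mapping_eqI)
    (simp add: lookup_boundary lookup_minus graded_part_in_basis ring_distribs sum_subtractf)

lemma boundary_chain:
  assumes "c \<in> graded_part i"
  shows "boundary c \<in> graded_part (i + 1)"
  unfolding graded_part_iff
proof (intro allI impI)
  fix q assume "Poly_Mapping.lookup (boundary c) q \<noteq> 0"
  then obtain p where "p \<in> B" "Poly_Mapping.lookup c p * M p q \<noteq> 0"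
    unfolding lookup_boundary[OF graded_part_in_basis[OF assms]] by (rule sum.not_neutral_contains_not_neutral)
  then show "q \<in> B \<and> deg q = i + 1"
    using assms entry_degree[of p q] unfolding graded_part_iff by auto
qed

lemma boundary_boundary:
  assumes "c \<in> graded_part i"
  shows "boundary (boundary c) = 0"
proof (rule poly_mapping_eqI)
  fix r
  let ?l = "Poly_Mapping.lookup c"
  have "Poly_Mapping.lookup (boundary (boundary c)) r = (\<Sum>q\<in>B. (\<Sum>p\<in>B. ?l p * M p q) * M q r)"
    by (simp add: lookup_boundary[OF graded_part_in_basis[OF boundary_chain[OF assms]]]
      lookup_boundary[OF graded_part_in_basis[OF assms]])
  also have "\<dots> = (\<Sum>q\<in>B. \<Sum>p\<in>B. ?l p * (M p q * M q r))"
    by (simp add: sum_distrib_right mult.assoc)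
  also have "\<dots> = (\<Sum>p\<in>B. \<Sum>q\<in>B. ?l p * (M p q * M q r))"
    by (rule sum.swap)
  also have "\<dots> = (\<Sum>p\<in>B. ?l p * (\<Sum>q\<in>B. M p q * M q r))"
    by (simp add: sum_distrib_left)
  also have "\<dots> = 0"
  proof (cases "r \<in> B")
    case True
    then show ?thesis by (simp add: entries_compose_zero)
  next
    case False
    then have "M q r = 0" if "q \<in> B" for q using that entry_degree by blast
    then show ?thesis by simp
  qed
  finally show "Poly_Mapping.lookup (boundary (boundary c)) r = Poly_Mapping.lookup 0 r" by simp
qed

text \<open>
  This is the algebraic form of discrete Morse theory for a perfect matching of sources \<open>p \<in> L\<close>
  with targets \<open>m p\<close>. By the triangularity condition the matrix of the boundary map from
  sources to targets is invertible: ordering the sources by \<open>rank\<close> makes it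
  triangular with nonzero diagonal. Hence a chain can be changed by a boundary so that it vanishes
  on all targets, and a cycle that vanishes on all targets is zero.
\<close>

lemma exact_if_acyclic_matching:
  fixes m :: "'b \<Rightarrow> 'b" and rank :: "'b \<Rightarrow> nat"
  assumes lower: "L \<subseteq> B"
    and cover: "B \<subseteq> L \<union> m ` L"
    and pivot: "\<And>p. p \<in> L \<Longrightarrow> M p (m p) \<noteq> 0"
    and triangular: "\<And>p q. p \<in> L \<Longrightarrow> q \<in> L \<Longrightarrow> p \<noteq> q \<Longrightarrow> M p (m q) \<noteq> 0 \<Longrightarrow> rank q < rank p"
    and c: "c \<in> graded_part i" "boundary c = 0"
  shows "c \<in> boundary ` graded_part (i - 1)"
proof -
  let ?l = "Poly_Mapping.lookup"
  have finL: "finite L" using lower finite_basis finite_subset by blast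
  have clear: "\<exists>a \<in> graded_part (i - 1). \<forall>q\<in>L. ?l (c - boundary a) (m q) = 0"
    if "c \<in> graded_part i" "\<And>q. q \<in> L \<Longrightarrow> k \<le> rank q \<Longrightarrow> ?l c (m q) = 0" for c k
    using that
  proof (induction k arbitrary: c)
    case 0
    have "boundary 0 = 0" by (simp add: boundary_def)
    with 0 show ?case by (intro bexI[of _ 0]) (auto simp: zero_chain)
  next
    case (Suc k)
    \<comment> \<open>Clearing all targets of rank \<open>k\<close> at once disturbs only targets of smaller rank,
      so these quotients are the right coefficients for the whole layer.\<close>
    define f where "f p = (if p \<in> L \<and> rank p = k then ?l c (m p) / M p (m p) else 0)" for p
    have "finite {p. f p \<noteq> 0}" by (rule finite_subset[OF _ finL]) (auto simp: f_def)
    then obtain a where la: "?l a = f" using Abs_poly_mapping_inverse by blast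
    have a: "a \<in> graded_part (i - 1)"
      unfolding graded_part_iff la
    proof (intro allI impI)
      fix p assume "f p \<noteq> 0"
      then have p: "p \<in> L" "?l c (m p) \<noteq> 0" by (auto simp: f_def split: if_splits)
      then have "deg (m p) = i" using Suc.prems(1) unfolding graded_part_iff by blast
      then show "p \<in> B \<and> deg p = i - 1"
        using entry_degree[OF _ pivot[OF p(1)]] p(1) lower by auto
    qed
    have da: "?l (boundary a) (m q) = f q * M q (m q)" if q: "q \<in> L" "k \<le> rank q" for q
    proof -
      have "?l (boundary a) (m q) = (\<Sum>p\<in>B. f p * M p (m q))"
        using lookup_boundary[OF graded_part_in_basis[OF a]] la by simp
      also have "\<dots> = (\<Sum>p\<in>{q}. f p * M p (m q))"
      proof (rule sum.mono_neutral_right[OF finite_basis])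
        show "{q} \<subseteq> B" using q lower by auto
        show "\<forall>p\<in>B - {q}. f p * M p (m q) = 0"
        proof
          fix p assume p: "p \<in> B - {q}"
          have "M p (m q) = 0" if "f p \<noteq> 0"
            using that p q triangular[of p q] by (fastforce simp: f_def split: if_splits)
          then show "f p * M p (m q) = 0" by auto
        qed
      qed
      finally show ?thesis by simp
    qed
    have "?l (c - boundary a) (m q) = 0" if q: "q \<in> L" "k \<le> rank q" for q
    proof (cases "rank q = k")
      case True
      then show ?thesis using q pivot[of q] da[OF q] by (simp add: lookup_minus f_def)
    next
      case False
      then show ?thesis using q Suc.prems(2)[of q] da[OF q] by (simp add: lookup_minus f_def)
    qed
    moreover have "c - boundary a \<in> graded_part i"
      using diff_chain[OF Suc.prems(1), of "boundary a"] boundary_chain[OF a] by simp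
    ultimately obtain a' where a': "a' \<in> graded_part (i - 1)"
      "\<forall>q\<in>L. ?l (c - boundary a - boundary a') (m q) = 0"
      using Suc.IH[of "c - boundary a"] by auto
    then show ?case
      using a add_chain[OF a a'(1)] boundary_add[OF a a'(1)]
      by (intro bexI[of _ "a + a'"]) (auto simp: diff_diff_eq)
  qed
  obtain N where N: "\<forall>q\<in>L. rank q < N"
    using finL finite_nat_set_iff_bounded[of "rank ` L"] by auto
  obtain a where a: "a \<in> graded_part (i - 1)" and am: "\<forall>q\<in>L. ?l (c - boundary a) (m q) = 0"
    using clear[OF c(1), of N] N by force
  \<comment> \<open>What is left over is a cycle \<open>z\<close> supported on sources; its terms of largest rank
    have nothing to cancel against in the boundary, so \<open>z\<close> is zero.\<close>
  define z where "z = c - boundary a"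
  have zm: "\<forall>q\<in>L. ?l z (m q) = 0" using am by (simp add: z_def)
  have da: "boundary a \<in> graded_part i" using boundary_chain[OF a] by simp
  have z: "z \<in> graded_part i" unfolding z_def by (rule diff_chain[OF c(1) da])
  have dz: "boundary z = 0" unfolding z_def by (simp add: boundary_diff[OF c(1) da] c(2) boundary_boundary[OF a])
  have supp: "p \<in> L" if "?l z p \<noteq> 0" for p
    using that z zm cover unfolding graded_part_iff by blast
  have "z = 0"
  proof (rule ccontr)
    assume "z \<noteq> 0"
    then have "Poly_Mapping.keys z \<noteq> {}" by simp
    then obtain p where p: "?l z p \<noteq> 0" and top: "\<And>q. ?l z q \<noteq> 0 \<Longrightarrow> rank q \<le> rank p"
      using Max_in[of "rank ` Poly_Mapping.keys z"] Max_ge[of "rank ` Poly_Mapping.keys z"]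
      by (fastforce simp: in_keys_iff)
    have pL: "p \<in> L" using supp p by blast
    have "0 = ?l (boundary z) (m p)" using dz by simp
    also have "\<dots> = (\<Sum>q\<in>B. ?l z q * M q (m p))"
      by (rule lookup_boundary[OF graded_part_in_basis[OF z]])
    also have "\<dots> = (\<Sum>q\<in>{p}. ?l z q * M q (m p))"
    proof (rule sum.mono_neutral_right[OF finite_basis])
      show "{p} \<subseteq> B" using pL lower by auto
      show "\<forall>q\<in>B - {p}. ?l z q * M q (m p) = 0"
      proof
        fix q assume q: "q \<in> B - {p}"
        have "M q (m p) = 0" if "?l z q \<noteq> 0"
          using that q pL triangular[of q p] supp[of q] top[of q] by fastforce
        then show "?l z q * M q (m p) = 0" by auto
      qed
    qed
    finally show False using p pivot[OF pL] by simp
  qed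
  then have "c = boundary a" by (simp add: z_def)
  then show ?thesis using a by blast
qed

end

lemma trivial_quotient_by_itself:
  fixes Z :: "'a::ab_group_add set"
  assumes zero: "0 \<in> Z" and diff: "\<And>x y. x \<in> Z \<Longrightarrow> y \<in> Z \<Longrightarrow> x - y \<in> Z"
  shows "trivial_group (\<lparr>carrier = Z, monoid.mult = (+), one = 0\<rparr> Mod Z)"
proof -
  let ?G = "\<lparr>carrier = Z, monoid.mult = (+), one = (0::'a)\<rparr>"
  have neg: "- x \<in> Z" if "x \<in> Z" for x using diff[OF zero that] by simp
  have add: "x + y \<in> Z" if "x \<in> Z" "y \<in> Z" for x y using diff[OF that(1) neg[OF that(2)]] by simp
  interpret G: comm_group ?G
    by (rule comm_groupI) (use zero neg add in \<open>auto simp: ac_simps intro: bexI[of _ "- _"]\<close>)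
  have sub: "subgroup Z ?G" using G.subgroup_self by simp
  interpret Q: group "?G Mod Z"
    by (rule normal.factorgroup_is_group[OF G.subgroup_imp_normal[OF sub]])
  have "Z #>\<^bsub>?G\<^esub> x = Z" if "x \<in> Z" for x
    using G.coset_join2[OF _ sub] that by simp
  then have "carrier (?G Mod Z) \<subseteq> {Z}"
    by (auto simp: FactGroup_def RCOSETS_def)
  then show ?thesis unfolding Q.trivial_group_alt by blast
qed

section \<open>Connected components and pendant vertices\<close>

text \<open>
  Reachability inside \<open>S\<close> is compared for different \<open>S\<close> below, so components are
  taken with respect to a fixed adjacency relation rather than in a subgraph that changes with
  \<open>S\<close>.
\<close>

definition component_of :: "'v rel \<Rightarrow> 'v set \<Rightarrow> 'v \<Rightarrow> 'v set" where
  "component_of A S a = {b. (a, b) \<in> rtrancl_on S A}"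

definition components :: "'v rel \<Rightarrow> 'v set \<Rightarrow> 'v set set" where
  "components A S = component_of A S ` S"

lemma component_of_subset: "component_of A S a \<subseteq> S"
  by (auto simp: component_of_def dest: in_rtrancl_on_in_F)

lemma component_of_refl: "a \<in> S \<Longrightarrow> a \<in> component_of A S a"
  by (simp add: component_of_def)

lemma component_of_eq:
  assumes "sym A" "b \<in> component_of A S a"
  shows "component_of A S b = component_of A S a"
proof -
  have "sym (rtrancl_on S A)" using assms(1) by (rule rtrancl_on_sym)
  then have "(b, a) \<in> rtrancl_on S A" "(a, b) \<in> rtrancl_on S A"
    using assms(2) by (auto simp: component_of_def dest: symD)
  then show ?thesis by (auto simp: component_of_def intro: rtrancl_on_trans)
qed

lemma component_subset: "x \<in> components A S \<Longrightarrow> x \<subseteq> S"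
  using component_of_subset by (fastforce simp: components_def)

lemma component_nonempty: "x \<in> components A S \<Longrightarrow> x \<noteq> {}"
  using component_of_refl by (fastforce simp: components_def)

lemma component_is_component_of:
  assumes "sym A" "x \<in> components A S" "a \<in> x"
  shows "x = component_of A S a"
  using assms component_of_eq by (fastforce simp: components_def)

text \<open>
  The common part is given by a nonempty subset \<open>z\<close> because in the applications it is a
  component of a smaller set.
\<close>

lemma components_eq_if_meet:
  assumes "sym A" "x \<in> components A S" "y \<in> components A S" "z \<subseteq> x" "z \<subseteq> y" "z \<noteq> {}"
  shows "x = y"
  using assms component_is_component_of by (metis ex_in_conv subsetD)

lemma rtrancl_on_mono_set:
  assumes "S \<subseteq> S'"
  shows "rtrancl_on S A \<subseteq> rtrancl_on S' A"
proof
  fix e assume "e \<in> rtrancl_on S A"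
  then have "(fst e, snd e) \<in> rtrancl_on S A" by simp
  then have "(fst e, snd e) \<in> rtrancl_on S' A"
    by (induction rule: rtrancl_on_induct) (use assms in \<open>auto intro: rtrancl_on_into_rtrancl_on\<close>)
  then show "e \<in> rtrancl_on S' A" by simp
qed

lemma component_extends:
  assumes "S \<subseteq> S'" "x \<in> components A S"
  shows "\<exists>y\<in>components A S'. x \<subseteq> y"
  using assms rtrancl_on_mono_set[OF assms(1), of A]
  unfolding components_def component_of_def by blast

lemma reachable_induce_subgraph_iff:
  "reachable (G \<restriction> S) a b \<longleftrightarrow> (a, b) \<in> rtrancl_on S (arcs_ends G)"
proof -
  have ends: "(b, c) \<in> arcs_ends (G \<restriction> S) \<longleftrightarrow> (b, c) \<in> arcs_ends G \<and> b \<in> S \<and> c \<in> S" for b c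
    by (auto simp: arcs_ends_conv induce_subgraph_def)
  have "(a, b) \<in> rtrancl_on S (arcs_ends G)" if "(a, b) \<in> rtrancl_on S (arcs_ends (G \<restriction> S))"
    using that
  proof (induction rule: rtrancl_on_induct)
    case (step b c)
    then show ?case by (meson ends rtrancl_on_into_rtrancl_on)
  qed simp
  moreover have "(a, b) \<in> rtrancl_on S (arcs_ends (G \<restriction> S))"
    if "(a, b) \<in> rtrancl_on S (arcs_ends G)"
    using that
  proof (induction rule: rtrancl_on_induct)
    case (step b c)
    then show ?case by (meson ends rtrancl_on_into_rtrancl_on)
  qed simp
  ultimately show ?thesis unfolding reachable_def by auto
qed

lemma sccs_verts_induce_subgraph:
  assumes "sym (arcs_ends G)"
  shows "pre_digraph.sccs_verts (G \<restriction> S) = components (arcs_ends G) S" (is "?L = ?R")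
proof -
  let ?R = "\<lambda>a b. (a, b) \<in> rtrancl_on S (arcs_ends G)"
  have symR: "?R b a" if "?R a b" for a b
    using that rtrancl_on_sym[OF assms, of S] by (rule symD[rotated])
  have "x \<in> components (arcs_ends G) S" 
    if x: "x \<noteq> {}" "\<forall>a\<in>x. \<forall>b\<in>x. ?R a b" "\<forall>a\<in>x. \<forall>b. b \<notin> x \<longrightarrow> \<not> ?R a b \<or> \<not> ?R b a" for x
  proof -
    obtain a where a: "a \<in> x" using x(1) by blast
    then have "x = component_of (arcs_ends G) S a"
      using x(2,3) symR unfolding component_of_def by blast
    moreover have "a \<in> S" using a x(2) in_rtrancl_on_in_F by fast
    ultimately show ?thesis by (simp add: components_def)
  qed
  moreover have "x \<noteq> {} \<and> (\<forall>a\<in>x. \<forall>b\<in>x. ?R a b) \<and> (\<forall>a\<in>x. \<forall>b. b \<notin> x \<longrightarrow> \<not> ?R a b \<or> \<not> ?R b a)"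
    if x: "x \<in> components (arcs_ends G) S" for x
    using component_nonempty[OF x] component_is_component_of[OF assms x]
    unfolding component_of_def by blast
  ultimately show ?thesis
    unfolding pre_digraph.sccs_verts_def reachable_induce_subgraph_iff by blast
qed

text \<open>A leaf \<open>v\<close> with its neighbour \<open>u\<close>.\<close>

locale pendant_vertex =
  fixes A :: "'v rel" and v u :: 'v
  assumes symmetric_adjacency: "sym A"
    and adjacent: "(u, v) \<in> A"
    and only_neighbour: "(v, a) \<in> A \<Longrightarrow> a = u"
    and distinct_ends: "u \<noteq> v"
begin

definition attach :: "'v set \<Rightarrow> 'v set" where
  "attach x = (if u \<in> x then insert v x else x)"

text \<open>
  A walk that passes through \<open>v\<close> enters and leaves it through \<open>u\<close>, so it connects
  no two vertices that were not connected before. Hence adding \<open>v\<close> merges no components, and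
  the map induced on components is injective.
\<close>

lemma component_of_insert_pendant:
  assumes "v \<notin> S" "a \<in> S"
  shows "component_of A (insert v S) a = attach (component_of A S a)"
proof -
  let ?x = "component_of A S a"
  have "b \<in> attach ?x" if "(a, b) \<in> rtrancl_on (insert v S) A" for b
    using that
  proof (induction rule: rtrancl_on_induct)
    case base
    then show ?case using assms by (simp add: attach_def component_of_refl)
  next
    case (step b c)
    have into: "d \<in> ?x" if "e \<in> ?x" "(e, d) \<in> A" "d \<in> S" for e d
      using that by (auto simp: component_of_def intro: rtrancl_on_into_rtrancl_on)
    have v: "v \<notin> ?x" using assms(1) component_of_subset by fast
    show ?case
    proof (cases "c = v")
      case True
      then have "b = u"
        using step.hyps(2) only_neighbour symmetric_adjacency by (auto dest: symD)
      then show ?thesis using step.IH True distinct_ends by (auto simp: attach_def split: if_splits)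
    next
      case False
      then have c: "c \<in> S" using step.hyps by simp
      show ?thesis
      proof (cases "b = v")
        case True
        then have "c = u" using step.hyps(2) only_neighbour by simp
        then show ?thesis using step.IH True v by (auto simp: attach_def split: if_splits)
      next
        case False
        then have "b \<in> ?x" using step.IH by (auto simp: attach_def split: if_splits)
        then show ?thesis using into[of b c] c step.hyps(2) by (simp add: attach_def)
      qed
    qed
  qed
  moreover have "(a, b) \<in> rtrancl_on (insert v S) A" if "b \<in> attach ?x" for b
  proof -
    have old: "(a, b) \<in> rtrancl_on (insert v S) A" if "b \<in> ?x" for b
      using that rtrancl_on_mono_set[of S "insert v S" A] by (auto simp: component_of_def)
    show ?thesis
    proof (cases "b \<in> ?x")
      case False
      then have "b = v" "u \<in> ?x" using that by (auto simp: attach_def split: if_splits)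
      then show ?thesis using old[of u] adjacent by (auto intro: rtrancl_on_into_rtrancl_on)
    qed (rule old)
  qed
  ultimately show ?thesis unfolding component_of_def[of A "insert v S"] by blast
qed

lemma attach_component:
  assumes "v \<notin> S" "x \<in> components A S"
  shows "attach x \<in> components A (insert v S)"
  using assms component_of_insert_pendant by (auto simp: components_def)

text \<open>
  The cokernel of the map induced by adding \<open>v\<close> is thus spanned by the singleton
  component \<open>{v}\<close>, when it exists.
\<close>

lemma component_is_attached:
  assumes "v \<notin> S" "y \<in> components A (insert v S)" "y \<noteq> {v}"
  obtains x where "x \<in> components A S" "y = attach x"
proof -
  obtain a where a: "a \<in> y" "a \<noteq> v"
    using assms(3) component_nonempty[OF assms(2)] by blast
  then have "a \<in> S" using component_subset[OF assms(2)] by blast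
  moreover have "y = component_of A (insert v S) a"
    using component_is_component_of[OF symmetric_adjacency assms(2) a(1)] .
  ultimately show thesis
    using that[of "component_of A S a"] component_of_insert_pendant[OF assms(1)]
    by (auto simp: components_def)
qed

lemma singleton_component_iff: "{v} \<in> components A S \<longleftrightarrow> v \<in> S \<and> u \<notin> S"
proof
  assume L: "{v} \<in> components A S"
  then have v: "v \<in> S" using component_subset by fast
  have "{v} = component_of A S v" 
    using component_is_component_of[OF symmetric_adjacency L] by simp
  moreover have "u \<in> component_of A S v" if "u \<in> S"
    using that v adjacent symmetric_adjacency
    by (auto simp: component_of_def dest: symD intro!: rtrancl_on_into_rtrancl_on[of v v])
  ultimately show "v \<in> S \<and> u \<notin> S" using v distinct_ends by auto
next
  assume R: "v \<in> S \<and> u \<notin> S"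
  have "b = v" if "(v, b) \<in> rtrancl_on S A" for b
    using that
  proof (induction rule: rtrancl_on_induct)
    case (step b c)
    then show ?case using only_neighbour R by auto
  qed simp
  then have "component_of A S v = {v}" using R by (auto simp: component_of_def)
  then show "{v} \<in> components A S" using R by (auto simp: components_def)
qed

end

section \<open>A pendant vertex in a tree\<close>

text \<open>
  The pendant vertex is the initial vertex \<open>v\<close> of a longest path. Each neighbour \<open>w\<close>
  of \<open>v\<close> lies on that path, since otherwise it could be prepended. If \<open>w\<close> is not the
  second vertex of the path, then the segment from \<open>v\<close> to \<open>w\<close> and the edge back
  to \<open>v\<close> form a cycle of length at least 3.
\<close>

lemma simple_tree_has_pendant_vertex:
  assumes "simple_tree T" and "2 \<le> card (verts T)"
  obtains u v where "(u, v) \<in> arcs_ends T" "u \<noteq> v" "\<And>a. (v, a) \<in> arcs_ends T \<Longrightarrow> a = u"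
proof -
  interpret graph T using assms(1) by (simp add: simple_tree_def)
  have acyclic: "\<not> (\<exists>p. cycle p \<and> 3 \<le> length p)"
    using assms(1) by (simp add: simple_tree_def)
  obtain a b where ab: "a \<in> verts T" "b \<in> verts T" "a \<noteq> b"
    using assms(2) card_le_Suc0_iff_eq[OF finite_verts] by fastforce
  have "strongly_connected T"
    using assms(1) symmetric_connected_imp_strongly_connected[OF sym_arcs]
    by (simp add: simple_tree_def)
  then obtain p where "apath a p b"
    using ab(1,2) reachable_apath by blast
  then have "(case (a, p, b) of (u, q, z) \<Rightarrow> apath u q z)" by simp
  then obtain v q z where q: "apath v q z"
    and longest: "\<And>u r z. apath u r z \<Longrightarrow> length r \<le> length q"
    using ex_has_greatest_nat[of "\<lambda>(u, q, z). apath u q z" "(a, p, b)" "\<lambda>(u, q, z). length q"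
        "card (verts T)"] length_apath_less
    by auto metis
  have "p \<noteq> []" using \<open>apath a p b\<close> ab(3) apath_Nil_iff by metis
  then have "q \<noteq> []" using longest[OF \<open>apath a p b\<close>] by auto
  obtain e es where e: "q = e # es" using \<open>q \<noteq> []\<close> by (cases q) auto
  then have ev: "tail T e = v" "e \<in> arcs T" using q by (auto simp: apath_Cons_iff)
  have only: "w = head T e" if vw: "(v, w) \<in> arcs_ends T" for w
  proof -
    have "(w, v) \<in> arcs_ends T" by (rule arcs_ends_symmetric[OF sym_arcs vw])
    then obtain f where f: "f \<in> arcs T" "tail T f = w" "head T f = v"
      by (auto simp: arcs_ends_conv)
    have "w \<in> set (awalk_verts v q)"
    proof (rule ccontr)
      assume "w \<notin> set (awalk_verts v q)"
      then have "apath w (f # q) z" using f q by (simp add: apath_Cons_iff)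
      then show False using longest by fastforce
    qed
    then obtain k r where k: "q = k @ r" "awalk v k w"
      using awalk_decomp[OF awalkI_apath[OF q]] by blast
    have "distinct (awalk_verts v k)"
      using q k apath_append_iff[of v k r z] by (simp add: apath_def)
    then have "cycle (f # k)"
      unfolding cycle_def using k(2) f by (intro exI[of _ w]) (auto simp: awalk_Cons_iff)
    then have "length k \<le> 1" using acyclic by fastforce
    moreover have "k \<noteq> []" using k(2) f no_loops[OF f(1)] by (auto simp: awalk_Nil_iff)
    ultimately have "k = [e]" using k(1) e by (cases k) auto
    then show ?thesis using k(2) by (auto simp: awalk_Cons_iff awalk_Nil_iff)
  qed
  have "(v, head T e) \<in> arcs_ends T"
    using ev by (auto simp: arcs_ends_conv)
  then have ends: "(head T e, v) \<in> arcs_ends T" by (rule arcs_ends_symmetric[OF sym_arcs])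
  have "head T e \<noteq> v" using no_loops[OF ev(2)] ev(1) by simp
  then show thesis using that[OF ends _ only] by simp
qed

section \<open>The bold complex\<close>

definition ones :: "('v, 'e) pre_digraph \<Rightarrow> 'v bicolouring \<Rightarrow> 'v set" where
  "ones G \<epsilon> = {v \<in> verts G. \<epsilon> v = 1}"

lemma comps_eq_components:
  assumes "sym (arcs_ends G)"
  shows "comps G \<epsilon> = components (arcs_ends G) (ones G \<epsilon>)"
  unfolding comps_def coloured_subgraph_def ones_def by (rule sccs_verts_induce_subgraph[OF assms])

lemma ones_upd: "v \<in> verts G \<Longrightarrow> ones G (\<epsilon>(v := 1)) = insert v (ones G \<epsilon>)"
  by (auto simp: ones_def)

lemma bicolouring_upd:
  "\<epsilon> \<in> bicolourings G \<Longrightarrow> v \<in> verts G \<Longrightarrow> k \<in> {0, 1} \<Longrightarrow> \<epsilon>(v := k) \<in> bicolourings G"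
  unfolding bicolourings_def by (metis PiE_fun_upd insert_absorb)

lemma bicolouring_values: "\<epsilon> \<in> bicolourings G \<Longrightarrow> v \<in> verts G \<Longrightarrow> \<epsilon> v = 0 \<or> \<epsilon> v = 1"
  by (auto simp: bicolourings_def PiE_def)

lemma covers_iff:
  "covers G \<epsilon> \<epsilon>' \<longleftrightarrow> \<epsilon> \<in> bicolourings G \<and> (\<exists>v\<in>verts G. \<epsilon> v = 0 \<and> \<epsilon>' = \<epsilon>(v := 1))"
  unfolding covers_def using bicolouring_upd[of \<epsilon> G _ 1] by auto

definition generators :: "('v, 'e) pre_digraph \<Rightarrow> ('v bicolouring \<times> 'v set) set" where
  "generators G = {(\<epsilon>, x). \<epsilon> \<in> bicolourings G \<and> x \<in> comps G \<epsilon>}"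

definition weight :: "('v, 'e) pre_digraph \<Rightarrow> 'v bicolouring \<times> 'v set \<Rightarrow> int" where
  "weight G p = int (\<Sum>v\<in>verts G. fst p v)"

definition incidence :: "('v, 'e) pre_digraph \<Rightarrow> ('v bicolouring \<Rightarrow> 'v bicolouring \<Rightarrow> nat) \<Rightarrow>
    'v bicolouring \<times> 'v set \<Rightarrow> 'v bicolouring \<times> 'v set \<Rightarrow> 'k::field" where
  "incidence G s p q =
     (if covers G (fst p) (fst q) \<and> snd q \<in> comps G (fst q) \<and> snd p \<subseteq> snd q
      then (- 1) ^ s (fst p) (fst q) else 0)"

lemma incidence_nonzero_iff:
  "incidence G s (\<epsilon>, x) (\<epsilon>', y) \<noteq> (0::'k::field) \<longleftrightarrow> covers G \<epsilon> \<epsilon>' \<and> y \<in> comps G \<epsilon>' \<and> x \<subseteq> y"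
  by (simp add: incidence_def)

lemma covers_component:
  assumes "sym (arcs_ends G)" "covers G \<epsilon> \<epsilon>'" "x \<in> comps G \<epsilon>"
  obtains y where "y \<in> comps G \<epsilon>'" "x \<subseteq> y"
    and "\<And>z. z \<in> comps G \<epsilon>' \<Longrightarrow> x \<subseteq> z \<Longrightarrow> z = y"
proof -
  have "ones G \<epsilon> \<subseteq> ones G \<epsilon>'" using assms(2) by (auto simp: covers_def ones_def)
  from component_extends[OF this] obtain y
    where "y \<in> components (arcs_ends G) (ones G \<epsilon>')" "x \<subseteq> y"
    using assms(3) comps_eq_components[OF assms(1)] by metis
  moreover have "x \<noteq> {}" using assms(3) component_nonempty comps_eq_components[OF assms(1)] by metis
  ultimately show thesis
    using that[of y] components_eq_if_meet[OF assms(1)] by (metis comps_eq_components[OF assms(1)])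
qed

text \<open>
  Intervals of length two in the cube of bi-colourings have exactly two interior points; the sign
  rule makes their contributions to the square of the differential cancel.
\<close>

lemma covers_between:
  assumes "covers G \<epsilon> \<epsilon>1" "covers G \<epsilon>1 \<epsilon>''"
  obtains \<epsilon>2 where "covers G \<epsilon> \<epsilon>2" "covers G \<epsilon>2 \<epsilon>''" "\<epsilon>1 \<noteq> \<epsilon>2"
    and "\<And>\<eta>. covers G \<epsilon> \<eta> \<Longrightarrow> covers G \<eta> \<epsilon>'' \<Longrightarrow> \<eta> = \<epsilon>1 \<or> \<eta> = \<epsilon>2"
proof -
  obtain a where a: "a \<in> verts G" "\<epsilon> a = 0" "\<epsilon>1 = \<epsilon>(a := 1)" and \<epsilon>: "\<epsilon> \<in> bicolourings G"
    using assms(1) unfolding covers_iff by blast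
  obtain b where b: "b \<in> verts G" "\<epsilon>1 b = 0" "\<epsilon>'' = \<epsilon>1(b := 1)"
    using assms(2) unfolding covers_iff by blast
  have ab: "a \<noteq> b" using a b by auto
  then have b0: "\<epsilon> b = 0" using a b by simp
  let ?\<epsilon>2 = "\<epsilon>(b := 1)"
  have "covers G \<epsilon> ?\<epsilon>2" unfolding covers_iff using \<epsilon> b(1) b0 by blast
  moreover have "covers G ?\<epsilon>2 \<epsilon>''"
    unfolding covers_iff using bicolouring_upd[OF \<epsilon> b(1), of 1] a b ab
    by (auto simp: fun_upd_twist intro!: bexI[of _ a])
  moreover have "\<epsilon>1 \<noteq> ?\<epsilon>2" using a(3) ab b0 by (auto dest: fun_cong[of _ _ b])
  moreover have "\<eta> = \<epsilon>1 \<or> \<eta> = ?\<epsilon>2" if \<eta>: "covers G \<epsilon> \<eta>" "covers G \<eta> \<epsilon>''" for \<eta>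
  proof -
    obtain c where c: "\<epsilon> c = 0" "\<eta> = \<epsilon>(c := 1)" using \<eta>(1) unfolding covers_iff by auto
    obtain d where d: "\<epsilon>'' = \<eta>(d := 1)" using \<eta>(2) unfolding covers_iff by auto
    have "\<epsilon>'' c = 1" using c d by auto
    then have "c = a \<or> c = b" using a(3) b(3) c(1) by (auto split: if_splits)
    then show ?thesis using a c by auto
  qed
  ultimately show thesis by (rule that)
qed

lemma opposite_signs:
  assumes "(i + j) mod 2 = (k + l + 1) mod (2::nat)"
  shows "(- 1) ^ i * (- 1) ^ j + (- 1) ^ k * (- 1) ^ l = (0::'k::field)"
proof -
  have "even (i + j) \<longleftrightarrow> odd (k + l)" using assms by presburger
  then show ?thesis by (auto simp flip: power_add simp add: minus_one_power_iff)
qed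

lemma bold_based_complex:
  assumes "graph G" "sign_assignment G s"
  shows "based_complex (generators G) (weight G) (incidence G s :: _ \<Rightarrow> _ \<Rightarrow> 'k::field)"
proof -
  interpret graph G by fact
  have sym: "sym (arcs_ends G)" using sym_arcs by (simp add: symmetric_def)
  let ?M = "incidence G s :: _ \<Rightarrow> _ \<Rightarrow> 'k"
  have fin: "finite (generators G)"
  proof -
    have "finite (bicolourings G)" unfolding bicolourings_def by (simp add: finite_PiE)
    moreover have "comps G \<epsilon> \<subseteq> Pow (verts G)" for \<epsilon>
      using component_subset by (fastforce simp: comps_eq_components[OF sym] ones_def)
    then have "generators G \<subseteq> bicolourings G \<times> Pow (verts G)" unfolding generators_def by blast
    ultimately show ?thesis by (meson finite_Pow_iff finite_SigmaI finite_subset finite_verts)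
  qed
  show ?thesis
  proof
    show "finite (generators G)" by (rule fin)
  next
    fix p q assume "p \<in> generators G" "?M p q \<noteq> 0"
    then have c: "covers G (fst p) (fst q)" and q: "snd q \<in> comps G (fst q)"
      by (auto simp: incidence_def split: if_splits)
    obtain v where v: "v \<in> verts G" "fst p v = 0" "fst q = (fst p)(v := 1)"
      using c unfolding covers_def by blast
    have "(\<Sum>u\<in>verts G. fst q u) = 1 + (\<Sum>u\<in>verts G. fst p u)"
      using v sum.remove[OF finite_verts v(1), of "fst q"] sum.remove[OF finite_verts v(1), of "fst p"]
      by simp
    then show "q \<in> generators G \<and> weight G q = weight G p + 1"
      using c q by (auto simp: generators_def covers_def weight_def case_prod_beta)
  next
    fix p r assume p: "p \<in> generators G" and r: "r \<in> generators G"
    obtain \<epsilon> x where px: "p = (\<epsilon>, x)" "x \<in> comps G \<epsilon>" using p by (auto simp: generators_def)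
    obtain \<epsilon>'' z where rz: "r = (\<epsilon>'', z)" "z \<in> comps G \<epsilon>''" using r by (auto simp: generators_def)
    \<comment> \<open>Along each of the two ways from \<open>\<epsilon>\<close> to \<open>\<epsilon>''\<close> the component passed is
      determined by \<open>x\<close>.\<close>
    have step: "\<exists>!y. ?M p (\<epsilon>', y) * ?M (\<epsilon>', y) r \<noteq> 0"
      if c: "covers G \<epsilon> \<epsilon>'" "covers G \<epsilon>' \<epsilon>''" "x \<subseteq> z" for \<epsilon>'
    proof -
      obtain y where y: "y \<in> comps G \<epsilon>'" "x \<subseteq> y" "\<And>y'. y' \<in> comps G \<epsilon>' \<Longrightarrow> x \<subseteq> y' \<Longrightarrow> y' = y"
        by (rule covers_component[OF sym c(1) px(2)]) blast
      obtain z' where z': "z' \<in> comps G \<epsilon>''" "y \<subseteq> z'"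
        by (rule covers_component[OF sym c(2) y(1)])
      have "x \<noteq> {}" using px(2) component_nonempty comps_eq_components[OF sym] by metis
      then have "z' = z"
        using components_eq_if_meet[OF sym, of z' "ones G \<epsilon>''" z x] z' rz(2) y(2) c(3)
        by (auto simp: comps_eq_components[OF sym])
      show ?thesis
      proof (rule ex1I)
        show "?M p (\<epsilon>', y) * ?M (\<epsilon>', y) r \<noteq> 0"
          using c y(1,2) z' \<open>z' = z\<close> by (simp add: px(1) rz(1) incidence_nonzero_iff)
        show "y' = y" if "?M p (\<epsilon>', y') * ?M (\<epsilon>', y') r \<noteq> 0" for y'
          using that y(3)[of y'] by (simp add: px(1) rz(1) incidence_nonzero_iff)
      qed
    qed
    show "(\<Sum>q\<in>generators G. ?M p q * ?M q r) = 0"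
    proof (cases "\<exists>q. ?M p q * ?M q r \<noteq> 0")
      case False
      then show ?thesis by (intro sum.neutral) blast
    next
      case True
      then obtain \<epsilon>1 y where "?M p (\<epsilon>1, y) * ?M (\<epsilon>1, y) r \<noteq> 0" by auto
      then have c1: "covers G \<epsilon> \<epsilon>1" "covers G \<epsilon>1 \<epsilon>''" and xz: "x \<subseteq> z"
        by (auto simp: px rz incidence_nonzero_iff)
      obtain \<epsilon>2 where c2: "covers G \<epsilon> \<epsilon>2" "covers G \<epsilon>2 \<epsilon>''" "\<epsilon>1 \<noteq> \<epsilon>2"
        and only: "\<And>\<eta>. covers G \<epsilon> \<eta> \<Longrightarrow> covers G \<eta> \<epsilon>'' \<Longrightarrow> \<eta> = \<epsilon>1 \<or> \<eta> = \<epsilon>2"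
        by (rule covers_between[OF c1]) blast
      obtain y1 where y1: "?M p (\<epsilon>1, y1) * ?M (\<epsilon>1, y1) r \<noteq> 0"
        "\<And>y. ?M p (\<epsilon>1, y) * ?M (\<epsilon>1, y) r \<noteq> 0 \<Longrightarrow> y = y1"
        using step[OF c1 xz] by blast
      obtain y2 where y2: "?M p (\<epsilon>2, y2) * ?M (\<epsilon>2, y2) r \<noteq> 0"
        "\<And>y. ?M p (\<epsilon>2, y) * ?M (\<epsilon>2, y) r \<noteq> 0 \<Longrightarrow> y = y2"
        using step[OF c2(1,2) xz] by blast
      have "(\<Sum>q\<in>generators G. ?M p q * ?M q r) = (\<Sum>q\<in>{(\<epsilon>1, y1), (\<epsilon>2, y2)}. ?M p q * ?M q r)"
      proof (rule sum.mono_neutral_right[OF fin])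
        show "{(\<epsilon>1, y1), (\<epsilon>2, y2)} \<subseteq> generators G"
          using y1(1) y2(1) c1 c2 by (auto simp: generators_def px rz incidence_nonzero_iff covers_def)
        show "\<forall>q\<in>generators G - {(\<epsilon>1, y1), (\<epsilon>2, y2)}. ?M p q * ?M q r = 0"
        proof
          fix q assume q: "q \<in> generators G - {(\<epsilon>1, y1), (\<epsilon>2, y2)}"
          obtain \<eta> y where qy: "q = (\<eta>, y)" by (cases q)
          show "?M p q * ?M q r = 0"
          proof (rule ccontr)
            assume nz: "?M p q * ?M q r \<noteq> 0"
            then have "\<eta> = \<epsilon>1 \<or> \<eta> = \<epsilon>2"
              using only by (simp add: px rz qy incidence_nonzero_iff)
            then show False using nz q y1(2) y2(2) qy by auto
          qed
        qed
      qed
      also have "\<dots> = ?M p (\<epsilon>1, y1) * ?M (\<epsilon>1, y1) r + ?M p (\<epsilon>2, y2) * ?M (\<epsilon>2, y2) r"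
        using c2(3) by simp
      also have "\<dots> = (- 1) ^ s \<epsilon> \<epsilon>1 * (- 1) ^ s \<epsilon>1 \<epsilon>'' + (- 1) ^ s \<epsilon> \<epsilon>2 * (- 1) ^ s \<epsilon>2 \<epsilon>''"
        using y1(1) y2(1) by (auto simp: incidence_def px rz split: if_splits)
      also have "\<dots> = 0"
        by (rule opposite_signs)
          (use assms(2) c1 c2 in \<open>unfold sign_assignment_def, blast\<close>)
      finally show ?thesis .
    qed
  qed
qed

lemma bold_basis_eq: "bold_basis G i = {p \<in> generators G. weight G p = i}"
  unfolding bold_basis_def generators_def weight_def by auto

lemma bold_chain_group_eq:
  assumes "based_complex (generators G) (weight G) (incidence G s :: _ \<Rightarrow> _ \<Rightarrow> 'k::field)"
  shows "carrier (bold_chain_group G i) = (based_complex.graded_part (generators G) (weight G) i :: (_ \<Rightarrow>\<^sub>0 'k) set)"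
  by (simp add: bold_chain_group_def based_complex.graded_part_def[OF assms] bold_basis_eq)

lemma bold_differential_eq:
  assumes "based_complex (generators G) (weight G) (incidence G s :: _ \<Rightarrow> _ \<Rightarrow> 'k::field)"
  shows "bold_differential G s (c :: _ \<Rightarrow>\<^sub>0 'k) = based_complex.boundary (generators G) (incidence G s) c"
proof -
  have "(\<Sum>(\<epsilon>', y)\<in>{(\<epsilon>', y). covers G \<epsilon> \<epsilon>' \<and> y \<in> comps G \<epsilon>' \<and> x \<subseteq> y}.
          Poly_Mapping.single (\<epsilon>', y) (Poly_Mapping.lookup c (\<epsilon>, x) * (-1) ^ s \<epsilon> \<epsilon>'))
      = (\<Sum>q\<in>generators G. Poly_Mapping.single q (Poly_Mapping.lookup c (\<epsilon>, x) * incidence G s (\<epsilon>, x) q))"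
    for \<epsilon> x
    by (rule sum.mono_neutral_cong_left[OF based_complex.finite_basis[OF assms]])
      (auto simp: incidence_def generators_def covers_def)
  then show ?thesis
    unfolding bold_differential_def based_complex.boundary_def[OF assms] by (simp add: case_prod_beta)
qed

text \<open>
  The matching switches on the leaf \<open>v\<close> wherever it is off. This reaches every basis
  element with \<open>v\<close> on except the isolated components \<open>{v}\<close>. Those occur for
  all colourings with \<open>v\<close> on and \<open>u\<close> off, and they are matched among
  themselves by switching on \<open>w\<close>. The boundary of a source of the first kind hits no target
  of the second kind, while a source \<open>{v}\<close> of the second kind may hit a target of
  the first kind by switching on \<open>u\<close>. So the boundary matrix is block
  triangular and the value at \<open>v\<close>, which separates the two kinds, serves as rank.
\<close>

lemma bold_cycle_is_boundary:
  assumes G: "graph G" and s: "sign_assignment G s"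
    and pendant: "pendant_vertex (arcs_ends G) v u"
    and w: "w \<in> verts G" "w \<noteq> u" "w \<noteq> v"
    and c: "(c :: ('v, 'k::field) bold_chain) \<in> bold_cycles G s i"
  shows "c \<in> bold_boundaries G s i"
proof -
  interpret graph G by fact
  interpret pendant_vertex "arcs_ends G" v u by fact
  note sym = symmetric_adjacency
  note comps = comps_eq_components[OF sym]
  have v: "v \<in> verts G" using adjacent adj_in_verts by blast
  interpret K: based_complex "generators G" "weight G" "incidence G s :: _ \<Rightarrow> _ \<Rightarrow> 'k"
    by (rule bold_based_complex[OF G s])
  let ?M = "incidence G s :: _ \<Rightarrow> _ \<Rightarrow> 'k"
  define L where "L = {(\<epsilon>, x) \<in> generators G. \<epsilon> v = 0 \<or> x = {v} \<and> \<epsilon> w = 0}"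
  define m where
    "m = (\<lambda>(\<epsilon>, x). if \<epsilon> v = 0 then (\<epsilon>(v := 1), attach x) else (\<epsilon>(w := (1::nat)), {v}))"
  have off: "v \<notin> x" "x \<noteq> {}" "v \<notin> ones G \<epsilon>" if "x \<in> comps G \<epsilon>" "\<epsilon> v = 0" for x \<epsilon>
    using that component_subset component_nonempty by (fastforce simp: comps ones_def)+
  have "c \<in> K.boundary ` K.graded_part (i - 1)"
  proof (rule K.exact_if_acyclic_matching[where L = L and m = m and rank = "\<lambda>(\<epsilon>, x). \<epsilon> v"])
    show "L \<subseteq> generators G" by (auto simp: L_def)
    show "c \<in> K.graded_part i" "K.boundary c = 0"
      using c K.based_complex_axioms
      by (simp_all add: bold_cycles_def bold_chain_group_eq bold_differential_eq)
    show "generators G \<subseteq> L \<union> m ` L"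
    proof
      fix p assume p: "p \<in> generators G"
      obtain \<epsilon> x where px: "p = (\<epsilon>, x)" and \<epsilon>: "\<epsilon> \<in> bicolourings G" and x: "x \<in> comps G \<epsilon>"
        using p by (auto simp: generators_def)
      consider "\<epsilon> v = 0 \<or> x = {v} \<and> \<epsilon> w = 0" | "\<epsilon> v = 1" "x = {v}" "\<epsilon> w = 1" | "\<epsilon> v = 1" "x \<noteq> {v}"
        using bicolouring_values[OF \<epsilon>] v w(1) by blast
      then show "p \<in> L \<union> m ` L"
      proof cases
        case 1
        then show ?thesis using p px by (auto simp: L_def)
      next
        case 2
        let ?\<eta> = "\<epsilon>(w := 0)"
        have "{v} \<in> comps G ?\<eta>"
          using x 2 w v by (auto simp: comps singleton_component_iff ones_def)
        then have "(?\<eta>, {v}) \<in> L"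
          using bicolouring_upd[OF \<epsilon> w(1), of 0] by (simp add: L_def generators_def)
        moreover have "m (?\<eta>, {v}) = p" using 2 w px by (auto simp: m_def)
        ultimately show ?thesis by (metis UnI2 imageI)
      next
        case 3
        let ?\<eta> = "\<epsilon>(v := 0)"
        have \<epsilon>\<eta>: "\<epsilon> = ?\<eta>(v := 1)" using 3 by auto
        then have "ones G \<epsilon> = insert v (ones G ?\<eta>)" using ones_upd[OF v, of ?\<eta>] by simp
        then obtain y where y: "y \<in> comps G ?\<eta>" "x = attach y"
          using component_is_attached[of "ones G ?\<eta>" x] x 3(2) by (auto simp: comps ones_def)
        have "(?\<eta>, y) \<in> L"
          using bicolouring_upd[OF \<epsilon> v, of 0] y by (simp add: L_def generators_def)
        moreover have "m (?\<eta>, y) = p" using \<epsilon>\<eta> y px by (simp add: m_def)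
        ultimately show ?thesis by (metis UnI2 imageI)
      qed
    qed
    show "?M p (m p) \<noteq> 0" if pL: "p \<in> L" for p
    proof -
      obtain \<epsilon> x where px: "p = (\<epsilon>, x)" and \<epsilon>: "\<epsilon> \<in> bicolourings G" and x: "x \<in> comps G \<epsilon>"
        and kind: "\<epsilon> v = 0 \<or> x = {v} \<and> \<epsilon> w = 0"
        using pL by (auto simp: L_def generators_def)
      show ?thesis
      proof (cases "\<epsilon> v = 0")
        case True
        have "attach x \<in> comps G (\<epsilon>(v := 1))"
          using attach_component[OF off(3)[OF x True]] x unfolding comps ones_upd[OF v] by blast
        moreover have "x \<subseteq> attach x" by (auto simp: attach_def)
        ultimately show ?thesis
          using True \<epsilon> v by (auto simp: px m_def incidence_nonzero_iff covers_iff)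
      next
        case False
        then have k: "x = {v}" "\<epsilon> w = 0" using kind by auto
        have "{v} \<in> comps G (\<epsilon>(w := 1))"
          using x k w by (auto simp: comps singleton_component_iff ones_def)
        then show ?thesis
          using False k \<epsilon> w by (auto simp: px m_def incidence_nonzero_iff covers_iff)
      qed
    qed
    show "(case q of (\<epsilon>, x) \<Rightarrow> \<epsilon> v) < (case p of (\<epsilon>, x) \<Rightarrow> \<epsilon> v)"
      if pL: "p \<in> L" and qL: "q \<in> L" and ne: "p \<noteq> q" and nz: "?M p (m q) \<noteq> 0" for p q
    proof -
      obtain \<epsilon> x where px: "p = (\<epsilon>, x)" and \<epsilon>: "\<epsilon> \<in> bicolourings G" and x: "x \<in> comps G \<epsilon>"
        and pkind: "\<epsilon> v = 0 \<or> x = {v} \<and> \<epsilon> w = 0"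
        using pL by (auto simp: L_def generators_def)
      obtain \<eta> y where qy: "q = (\<eta>, y)" and \<eta>: "\<eta> \<in> bicolourings G" and y: "y \<in> comps G \<eta>"
        and qkind: "\<eta> v = 0 \<or> y = {v} \<and> \<eta> w = 0"
        using qL by (auto simp: L_def generators_def)
      have upd: "\<epsilon> = \<eta>" if t: "covers G \<epsilon> (\<eta>(t := 1))" "\<epsilon> t = 0" "\<eta> t = 0" for t
      proof -
        obtain a where a: "\<epsilon> a = 0" "\<eta>(t := 1) = \<epsilon>(a := 1)"
          using t(1) unfolding covers_iff by auto
        then have "a = t" using t(2) by (metis fun_upd_other fun_upd_same zero_neq_one)
        then show ?thesis using a(2) t by (metis fun_upd_triv fun_upd_upd)
      qed
      consider "\<epsilon> v = 0" "\<eta> v = 0" | "\<epsilon> v = 0" "\<eta> v \<noteq> 0" | "\<epsilon> v \<noteq> 0" "\<eta> v = 0" | "\<epsilon> v \<noteq> 0" "\<eta> v \<noteq> 0"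
        by blast
      then show ?thesis
      proof cases
        \<comment> \<open>Equal kinds force the same vertex to be switched on, and then \<open>p = q\<close>.\<close>
        case 1
        then have "covers G \<epsilon> (\<eta>(v := 1))" "x \<subseteq> attach y"
          using nz by (simp_all add: px qy m_def incidence_nonzero_iff)
        then have "\<epsilon> = \<eta>" "x \<subseteq> y"
          using upd[of v] 1 off(1)[OF x 1(1)] by (auto simp: attach_def split: if_splits)
        then have "x = y"
          using components_eq_if_meet[OF sym, of x "ones G \<epsilon>" y x] x y off(2)[OF x 1(1)]
          by (simp add: comps)
        then show ?thesis using ne px qy \<open>\<epsilon> = \<eta>\<close> by simp
      next
        \<comment> \<open>A component avoiding \<open>v\<close> cannot lie in \<open>{v}\<close>.\<close>
        case 2
        then have "x \<subseteq> {v}" using nz by (simp add: px qy m_def incidence_nonzero_iff)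
        then show ?thesis using off(1,2)[OF x 2(1)] by blast
      next
        case 3
        then show ?thesis by (simp add: px qy)
      next
        case 4
        then have "covers G \<epsilon> (\<eta>(w := 1))" using nz by (simp add: px qy m_def incidence_nonzero_iff)
        then show ?thesis using upd[of w] 4 pkind qkind ne px qy by simp
      qed
    qed
  qed
  then show ?thesis
    using K.based_complex_axioms
    by (simp add: bold_boundaries_def bold_chain_group_eq bold_differential_eq[OF K.based_complex_axioms, abs_def])
qed

section \<open>Bold homology of trees\<close>

theorem theorem5p1:
  fixes T :: "('v, 'e) pre_digraph"
    and s :: "'v bicolouring \<Rightarrow> 'v bicolouring \<Rightarrow> nat"
  assumes "simple_tree T"
    and "card (verts T) \<ge> 3"
    and "sign_assignment T s"
  shows "\<forall>i. trivial_group (bold_homology T s i :: ('v, 'k::field) bold_chain set monoid)"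
proof
  fix i :: int
  interpret graph T using assms(1) by (simp add: simple_tree_def)
  have sym: "sym (arcs_ends T)" using sym_arcs by (simp add: symmetric_def)
  obtain u v where uv: "(u, v) \<in> arcs_ends T" "u \<noteq> v" "\<And>a. (v, a) \<in> arcs_ends T \<Longrightarrow> a = u"
    by (rule simple_tree_has_pendant_vertex[OF assms(1)]) (use assms(2) in auto)
  then have pendant: "pendant_vertex (arcs_ends T) v u"
    using sym by unfold_locales
  \<comment> \<open>The number of vertices matters here: for a single edge the component \<open>{v}\<close> would
    have no partner.\<close>
  have "\<not> verts T \<subseteq> {u, v}"
    using assms(2) card_mono[of "{u, v}" "verts T"] card_insert_le_m1[of 2 "{v}" u] by auto
  then obtain w where w: "w \<in> verts T" "w \<noteq> u" "w \<noteq> v" by blast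
  interpret K: based_complex "generators T" "weight T" "incidence T s :: _ \<Rightarrow> _ \<Rightarrow> 'k"
    by (rule bold_based_complex[OF graph_axioms assms(3)])
  note group = bold_chain_group_eq[OF K.based_complex_axioms]
  note diff = bold_differential_eq[OF K.based_complex_axioms]
  let ?Z = "bold_cycles T s i :: ('v, 'k) bold_chain set"
  have Z: "?Z = {c \<in> K.graded_part i. K.boundary c = 0}"
    by (simp add: bold_cycles_def group diff)
  have "bold_boundaries T s i \<subseteq> ?Z"
    using K.boundary_chain[of _ "i - 1"] K.boundary_boundary by (auto simp: Z bold_boundaries_def group diff)
  then have exact: "bold_boundaries T s i = ?Z"
    using bold_cycle_is_boundary[OF graph_axioms assms(3) pendant w] by blast
  have "0 \<in> ?Z" by (simp add: Z K.zero_chain K.boundary_def)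
  moreover have "x - y \<in> ?Z" if "x \<in> ?Z" "y \<in> ?Z" for x y
    using that K.diff_chain K.boundary_diff by (auto simp: Z)
  ultimately have "trivial_group (\<lparr>carrier = ?Z, monoid.mult = (+), one = 0\<rparr> Mod ?Z)"
    by (rule trivial_quotient_by_itself)
  then show "trivial_group (bold_homology T s i :: ('v, 'k) bold_chain set monoid)"
    by (simp add: bold_homology_def exact bold_chain_group_def)
qed

end
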